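(* Let $p$ be a prime, $n\ge1$, and $F=\prod_{\nu=1}^n f_\nu$ with $f_\nu\in\mathcal{W}^0_{p,2}$; let $\xi_\nu\in\mathbb{Z}_p$ be the zero of $f_\nu$. Then \[ F(s)=p^n\prod_{\nu=1}^n(s-\xi_\nu)\cdot F^*(s),\qquad s\in\mathbb{Z}_p, \] where $F^*:\mathbb{Z}_p\to\mathbb{Z}_p^*$ is continuous and $F^*(s)\equiv\prod_{\nu=1}^n\Delta_{f_\nu}\pmod{p\mathbb{Z}_p}$. Moreover, \[ \Delta_F(n)\equiv n!\prod_{\nu=1}^n\Delta_{f_\nu}\pmod{p\mathbb{Z}_p}, \] $\operatorname{ord}_p\Delta_F(\nu)\ge n-\nu$ for $\nu=0,\ldots,n$, and $\lambda_F=n$ if $n<p$, while $\lambda_F>n$ otherwise.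
   Context: Let $\Delta^n f(s)=\sum_{\nu=0}^n\binom{n}{\nu}(-1)^{n-\nu}f(s+\nu)$. $\mathcal{K}_{p,2}$ is the set of $f:\mathbb{Z}_p\to\mathbb{Z}_p$ with $\Delta^n f(s)\equiv0\pmod{p^n\mathbb{Z}_p}$ for all $s\in\mathbb{Z}_p$, $n\ge0$; it is closed under pointwise products. For $f\in\mathcal{K}_{p,2}$, $\Delta_f(k)=\Delta^kf(0)/p^k\in\mathbb{Z}_p$, $\Delta_f$ is the integer in $[0,p)$ congruent to $\Delta_f(1)$ mod $p$, and $\lambda_f=\min\{k\ge0:\Delta_f(k)\in\mathbb{Z}_p^*\}$ ($\infty$ if none). $\mathcal{W}^0_{p,2}$ is the set of $f\in\mathcal{K}_{p,2}$ with $f(0)\in p\mathbb{Z}_p$, $\Delta_f\ne0$ and, if $p=2$, additionally $2\mid\Delta_f(2)$; each such $f$ has a unique zero in $\mathbb{Z}_p$.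
   Formalization: Functions in K_{p,2} are additionally required to be continuous; without this the claim fails, e.g. for n=1 and f(s)=ps on the integers, f=1 elsewhere in Z_p. *)

theory Defs
  imports "HOL-Analysis.Analysis" "Berlekamp_Zassenhaus.Finite_Field"
begin

section \<open>The ring of p-adic integers\<close>

text \<open>
  The prime is the cardinality of the type argument, which ranges over the class
  \<^class>\<open>prime_card\<close>. The ring is the inverse limit of the rings of integers modulo \<open>p ^ n\<close>:
  entry \<open>n\<close> of the sequence is the least nonnegative representative of the residue class
  modulo \<open>p ^ n\<close>. The range condition \<open>0 \<le> x n < p ^ n\<close> is part of the compatibility
  equation.
\<close>

typedef (overloaded) ('p :: prime_card) padic_int =
  "{x :: nat \<Rightarrow> int. \<forall>n. x (Suc n) mod int CARD('p) ^ n = x n}"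
  morphisms padic_rep Abs_padic_int
  by (rule exI[of _ "\<lambda>_. 0"]) simp

setup_lifting type_definition_padic_int

lemma padic_rep_Suc_mod:
  "padic_rep (x :: 'p::prime_card padic_int) (Suc n) mod int CARD('p) ^ n = padic_rep x n"
  using padic_rep[of x] by simp

lemma padic_rep_mod:
  assumes "m \<le> n"
  shows "padic_rep (x :: 'p::prime_card padic_int) n mod int CARD('p) ^ m = padic_rep x m"
  using assms
proof (induction n rule: dec_induct)
  case base
  show ?case by (metis padic_rep_Suc_mod mod_mod_trivial)
next
  case (step n)
  have "int CARD('p) ^ m dvd int CARD('p) ^ n"
    using step.hyps by (simp add: le_imp_power_dvd)
  then show ?case
    by (metis padic_rep_Suc_mod mod_mod_cancel step.IH)
qed

lemma padic_int_eqI: "(\<And>n. padic_rep x n = padic_rep y n) \<Longrightarrow> x = y"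
  by (metis ext padic_rep_inject)

lemma mod_Suc_power_mod: "(a mod (q::int) ^ Suc n) mod q ^ n = a mod q ^ n"
  by (simp add: mod_mod_cancel)

instantiation padic_int :: (prime_card) comm_ring_1
begin

lift_definition zero_padic_int :: "'a padic_int" is "\<lambda>_. 0" by simp

lift_definition one_padic_int :: "'a padic_int" is "\<lambda>n. 1 mod int CARD('a) ^ n"
  by (simp only: mod_Suc_power_mod)

lift_definition plus_padic_int :: "'a padic_int \<Rightarrow> 'a padic_int \<Rightarrow> 'a padic_int" is
  "\<lambda>x y n. (x n + y n) mod int CARD('a) ^ n"
  by (simp only: mod_Suc_power_mod) (metis mod_add_eq)

lift_definition uminus_padic_int :: "'a padic_int \<Rightarrow> 'a padic_int" is
  "\<lambda>x n. (- x n) mod int CARD('a) ^ n"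
  by (simp only: mod_Suc_power_mod) (metis mod_minus_eq)

lift_definition minus_padic_int :: "'a padic_int \<Rightarrow> 'a padic_int \<Rightarrow> 'a padic_int" is
  "\<lambda>x y n. (x n - y n) mod int CARD('a) ^ n"
  by (simp only: mod_Suc_power_mod) (metis mod_diff_eq)

lift_definition times_padic_int :: "'a padic_int \<Rightarrow> 'a padic_int \<Rightarrow> 'a padic_int" is
  "\<lambda>x y n. (x n * y n) mod int CARD('a) ^ n"
  by (simp only: mod_Suc_power_mod) (metis mod_mult_eq)

instance
proof
  fix a b c :: "'a padic_int"
  have self: "padic_rep x n mod int CARD('a) ^ n = padic_rep x n" for x :: "'a padic_int" and n
    by (rule padic_rep_mod) simp
  show "a + b + c = a + (b + c)"
    by (rule padic_int_eqI) (simp add: plus_padic_int.rep_eq mod_simps ac_simps)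
  show "a + b = b + a"
    by (rule padic_int_eqI) (simp add: plus_padic_int.rep_eq ac_simps)
  show "0 + a = a"
    by (rule padic_int_eqI) (simp add: plus_padic_int.rep_eq zero_padic_int.rep_eq self)
  show "- a + a = 0"
    by (rule padic_int_eqI)
      (simp add: plus_padic_int.rep_eq uminus_padic_int.rep_eq zero_padic_int.rep_eq mod_simps)
  show "a - b = a + - b"
    by (rule padic_int_eqI)
      (simp add: plus_padic_int.rep_eq uminus_padic_int.rep_eq minus_padic_int.rep_eq mod_simps)
  show "a * b * c = a * (b * c)"
    by (rule padic_int_eqI) (simp add: times_padic_int.rep_eq mod_simps ac_simps)
  show "a * b = b * a"
    by (rule padic_int_eqI) (simp add: times_padic_int.rep_eq ac_simps)
  show "1 * a = a"
    by (rule padic_int_eqI) (simp add: times_padic_int.rep_eq one_padic_int.rep_eq mod_simps self)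
  show "(a + b) * c = a * c + b * c"
    by (rule padic_int_eqI)
      (simp add: times_padic_int.rep_eq plus_padic_int.rep_eq mod_simps algebra_simps)
  have "padic_rep (0 :: 'a padic_int) 1 \<noteq> padic_rep 1 1"
    using prime_card[where 'a = 'a] prime_gt_1_nat[of "CARD('a)"]
    by (simp add: zero_padic_int.rep_eq one_padic_int.rep_eq)
  then show "(0 :: 'a padic_int) \<noteq> 1" by metis
qed

end

lemma padic_rep_of_nat:
  "padic_rep (of_nat m :: 'p::prime_card padic_int) n = int m mod int CARD('p) ^ n"
  by (induction m)
    (simp_all add: zero_padic_int.rep_eq one_padic_int.rep_eq plus_padic_int.rep_eq mod_simps ac_simps)

lemma padic_rep_eq_0_iff:
  "padic_rep (x :: 'p::prime_card padic_int) k = 0 \<longleftrightarrow> of_nat CARD('p) ^ k dvd x"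
proof
  assume "of_nat CARD('p) ^ k dvd x"
  then obtain y where "x = of_nat (CARD('p) ^ k) * y" by (auto elim: dvdE)
  then show "padic_rep x k = 0"
    by (simp add: times_padic_int.rep_eq padic_rep_of_nat del: of_nat_power) simp
next
  let ?p = "int CARD('p)"
  assume x0: "padic_rep x k = 0"
  have p0: "?p ^ n > 0" for n
    using prime_card[where 'a = 'p] by (simp add: prime_gt_0_nat)
  define y where "y = (\<lambda>n. padic_rep x (n + k) div ?p ^ k)"
  have split: "padic_rep x (n + k) = ?p ^ k * y n" for n
  proof -
    have "padic_rep x (n + k) mod ?p ^ k = 0"
      using padic_rep_mod[of k "n + k" x] x0 by simp
    then show ?thesis by (auto simp: y_def)
  qed
  have "y (Suc n) mod ?p ^ n = y n" for n
  proof -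
    have "?p ^ k * (y (Suc n) mod ?p ^ n) = (?p ^ k * y (Suc n)) mod (?p ^ (n + k))"
      by (simp only: power_add mult_mod_right mult.commute[of "?p ^ n"])
    also have "\<dots> = ?p ^ k * y n"
      using padic_rep_Suc_mod[of x "n + k"] split[of "Suc n"] split[of n]
      by (simp only: add_Suc)
    finally show ?thesis using p0[of k] by (metis mult_left_cancel less_irrefl)
  qed
  moreover define Y :: "'p padic_int" where "Y = Abs_padic_int y"
  ultimately have rep: "padic_rep Y = y"
    by (simp add: Abs_padic_int_inverse)
  have "x = of_nat (CARD('p) ^ k) * Y"
  proof (rule padic_int_eqI)
    fix n
    have "padic_rep (of_nat (CARD('p) ^ k) * Y) n = (?p ^ k * y n) mod ?p ^ n"
      by (simp add: times_padic_int.rep_eq padic_rep_of_nat rep mod_simps del: of_nat_power) simp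
    also have "\<dots> = padic_rep x n"
      using split[of n] padic_rep_mod[of n "n + k" x] by simp
    finally show "padic_rep x n = padic_rep (of_nat (CARD('p) ^ k) * Y) n" by simp
  qed
  then show "of_nat CARD('p) ^ k dvd x" by simp
qed

lemma padic_rep_eq_iff_dvd:
  "padic_rep (x :: 'p::prime_card padic_int) k = padic_rep y k \<longleftrightarrow> of_nat CARD('p) ^ k dvd (x - y)"
proof -
  have "padic_rep (x - y) k = 0 \<longleftrightarrow> padic_rep x k mod int CARD('p) ^ k = padic_rep y k mod int CARD('p) ^ k"
    by (simp add: minus_padic_int.rep_eq mod_eq_dvd_iff dvd_eq_mod_eq_0)
  then show ?thesis by (simp add: padic_rep_mod padic_rep_eq_0_iff)
qed

instance padic_int :: (prime_card) idom
proof
  fix a b :: "'a padic_int"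
  let ?p = "int CARD('a)"
  assume "a \<noteq> 0" "b \<noteq> 0"
  then obtain k l where kl: "padic_rep a k \<noteq> 0" "padic_rep b l \<noteq> 0"
    by (metis padic_int_eqI zero_padic_int.rep_eq)
  have pr: "prime ?p" by (rule prime_card_int)
  let ?x = "padic_rep a (k + l)" and ?y = "padic_rep b (k + l)"
  have x: "\<not> ?p ^ k dvd ?x" and y: "\<not> ?p ^ l dvd ?y"
    using kl padic_rep_mod[of k "k + l" a] padic_rep_mod[of l "k + l" b]
    by (auto simp: dvd_eq_mod_eq_0)
  then have nz: "?x \<noteq> 0" "?y \<noteq> 0" by auto
  have pu: "\<not> is_unit ?p" using pr by (metis not_prime_unit)
  have iff: "?p ^ m dvd z \<longleftrightarrow> m \<le> multiplicity ?p z" if "z \<noteq> 0" for m z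
    using that pu by (intro power_dvd_iff_le_multiplicity) auto
  have "multiplicity ?p (?x * ?y) = multiplicity ?p ?x + multiplicity ?p ?y"
    using nz pr by (intro prime_elem_multiplicity_mult_distrib prime_imp_prime_elem)
  then have "\<not> ?p ^ (k + l) dvd ?x * ?y"
    using x y iff[OF nz(1), of k] iff[OF nz(2), of l]
      iff[OF no_zero_divisors[OF nz], of "k + l"] by linarith
  then have "padic_rep (a * b) (k + l) \<noteq> padic_rep 0 (k + l)"
    by (simp add: times_padic_int.rep_eq zero_padic_int.rep_eq dvd_eq_mod_eq_0)
  then show "a * b \<noteq> 0" by metis
qed

abbreviation padic_p :: "'p::prime_card padic_int" where
  "padic_p \<equiv> of_nat CARD('p)"

text \<open>The valuation; it is \<open>\<infinity>\<close> exactly at \<open>0\<close>.\<close>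

definition padic_ord :: "'p::prime_card padic_int \<Rightarrow> enat" where
  "padic_ord x = (SUP k\<in>{k. padic_p ^ k dvd x}. enat k)"

definition padic_cong :: "'p::prime_card padic_int \<Rightarrow> 'p padic_int \<Rightarrow> bool" where
  "padic_cong x y \<longleftrightarrow> padic_p dvd (x - y)"

definition padic_units :: "'p::prime_card padic_int set" where
  "padic_units = {x. x dvd 1}"

lemma padic_ord_0 [simp]: "padic_ord (0 :: 'p::prime_card padic_int) = \<infinity>"
proof -
  have "enat k \<le> padic_ord (0 :: 'p padic_int)" for k
    unfolding padic_ord_def by (rule SUP_upper) simp
  then show ?thesis by (metis enat_ord_simps(4) less_enat_def not_le linorder_not_less
      enat_ord_simps(1) Suc_n_not_le_n not_infinity_eq)
qed

lemma le_padic_ord_iff: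
  "enat k \<le> padic_ord (x :: 'p::prime_card padic_int) \<longleftrightarrow> padic_p ^ k dvd x"
proof
  show "enat k \<le> padic_ord x" if "padic_p ^ k dvd x"
    unfolding padic_ord_def using that by (intro SUP_upper) simp
next
  assume le: "enat k \<le> padic_ord x"
  show "padic_p ^ k dvd x"
  proof (rule ccontr)
    assume nd: "\<not> padic_p ^ k dvd x"
    have small: "j < k" if "padic_p ^ j dvd x" for j
      using that nd by (meson dvd_trans le_imp_power_dvd not_le)
    have "k > 0" using nd by (cases k) auto
    have "padic_ord x \<le> enat (k - 1)"
      unfolding padic_ord_def using small by (intro SUP_least) fastforce
    then have "enat k \<le> enat (k - 1)" using le by (rule order.trans[rotated])
    then show False using \<open>k > 0\<close> by simp
  qed
qed

lemma padic_ord_eq_infinity_iff: "padic_ord x = \<infinity> \<longleftrightarrow> (x :: 'p::prime_card padic_int) = 0"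
proof
  assume "padic_ord x = \<infinity>"
  then have "padic_p ^ k dvd x" for k by (simp flip: le_padic_ord_iff)
  then have "padic_rep x k = padic_rep (0 :: 'p padic_int) k" for k
    by (simp add: padic_rep_eq_iff_dvd)
  then show "x = 0" by (rule padic_int_eqI)
qed simp

text \<open>The metric is induced by the absolute value \<open>p ^ (- ord x)\<close>.\<close>

instantiation padic_int :: (prime_card) metric_space
begin

definition dist_padic_int :: "'a padic_int \<Rightarrow> 'a padic_int \<Rightarrow> real" where
  "dist_padic_int x y =
     (if x = y then 0 else 1 / real CARD('a) ^ the_enat (padic_ord (x - y)))"

definition uniformity_padic_int :: "('a padic_int \<times> 'a padic_int) filter" where
  "uniformity_padic_int = (INF e\<in>{0<..}. principal {(x, y). dist x y < e})"

definition open_padic_int :: "'a padic_int set \<Rightarrow> bool" where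
  "open_padic_int U = (\<forall>x\<in>U. eventually (\<lambda>(x', y). x' = x \<longrightarrow> y \<in> U) uniformity)"

instance
proof
  have p1: "real CARD('a) > 1"
    using prime_card[where 'a = 'a] prime_gt_1_nat by auto
  then have pp: "real CARD('a) ^ n > 0" for n by simp
  fix x y z :: "'a padic_int"
  show "(dist x y = 0) = (x = y)"
    using p1 by (simp add: dist_padic_int_def)
  show "dist x y \<le> dist x z + dist y z"
  proof (cases "x = y \<or> x = z \<or> y = z")
    case True
    have "z - x = - (x - z)" for x z :: "'a padic_int" by simp
    then have "padic_ord (z - x) = padic_ord (x - z)" for x z :: "'a padic_int"
      unfolding padic_ord_def by (metis dvd_minus_iff)
    then show ?thesis using True p1 by (auto simp: dist_padic_int_def)
  next
    case False
    define i j k where "i = the_enat (padic_ord (x - y))"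
      and "j = the_enat (padic_ord (x - z))" and "k = the_enat (padic_ord (y - z))"
    have o: "padic_ord (x - y) = enat i" "padic_ord (x - z) = enat j" "padic_ord (y - z) = enat k"
      using False padic_ord_eq_infinity_iff[of "x - y"] padic_ord_eq_infinity_iff[of "x - z"]
        padic_ord_eq_infinity_iff[of "y - z"]
      unfolding i_def j_def k_def by auto
    have "padic_p ^ min j k dvd x - z" "padic_p ^ min j k dvd y - z"
      by (simp_all flip: le_padic_ord_iff add: o)
    then have "padic_p ^ min j k dvd (x - z) - (y - z)" by (rule dvd_diff)
    then have "padic_p ^ min j k dvd x - y" by simp
    then have "min j k \<le> i" by (simp flip: le_padic_ord_iff add: o)
    then have "real CARD('a) ^ min j k \<le> real CARD('a) ^ i"
      using p1 by (intro power_increasing) auto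
    then have "1 / real CARD('a) ^ i \<le> 1 / real CARD('a) ^ min j k"
      using pp by (intro divide_left_mono) auto
    also have "\<dots> \<le> 1 / real CARD('a) ^ j + 1 / real CARD('a) ^ k"
      using pp by (simp add: min_def)
    finally show ?thesis
      using False by (simp add: dist_padic_int_def i_def j_def k_def)
  qed
qed (fact uniformity_padic_int_def open_padic_int_def)+

end

section \<open>Kummer spaces\<close>

definition fwd_diff ::
    "nat \<Rightarrow> ('p::prime_card padic_int \<Rightarrow> 'p padic_int) \<Rightarrow> 'p padic_int \<Rightarrow> 'p padic_int" where
  "fwd_diff n f s = (\<Sum>\<nu>=0..n. of_nat (n choose \<nu>) * (- 1) ^ (n - \<nu>) * f (s + of_nat \<nu>))"

text \<open>
  Kummer spaces consist of continuous functions. Continuity does not follow from the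
  congruences, which only relate values within one coset of the integers: the indicator
  function of the integers satisfies all of them.
\<close>

definition kummer_space2 :: "('p::prime_card padic_int \<Rightarrow> 'p padic_int) set" where
  "kummer_space2 = {f. continuous_on UNIV f \<and> (\<forall>s n. padic_p ^ n dvd fwd_diff n f s)}"

text \<open>The quotient of the \<open>k\<close>-th difference at \<open>0\<close> by \<open>p ^ k\<close>; it is unique because the ring is a
  domain and \<open>p\<close> is nonzero in it.\<close>

definition kummer_coeff :: "('p::prime_card padic_int \<Rightarrow> 'p padic_int) \<Rightarrow> nat \<Rightarrow> 'p padic_int" where
  "kummer_coeff f k = (THE d. fwd_diff k f 0 = padic_p ^ k * d)"

definition kummer_residue :: "('p::prime_card padic_int \<Rightarrow> 'p padic_int) \<Rightarrow> nat" where
  "kummer_residue f = (THE d. d < CARD('p) \<and> padic_cong (of_nat d) (kummer_coeff f 1))"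

definition kummer_lambda :: "('p::prime_card padic_int \<Rightarrow> 'p padic_int) \<Rightarrow> enat" where
  "kummer_lambda f =
     (if \<exists>k. kummer_coeff f k \<in> padic_units
      then enat (LEAST k. kummer_coeff f k \<in> padic_units) else \<infinity>)"

definition kummer_W0 :: "('p::prime_card padic_int \<Rightarrow> 'p padic_int) set" where
  "kummer_W0 = {f \<in> kummer_space2. padic_p dvd f 0 \<and> kummer_residue f \<noteq> 0 \<and>
     (CARD('p) = 2 \<longrightarrow> 2 dvd kummer_coeff f 2)}"

end

theory Submission
  imports Defs
begin

text \<open>
  Let \<open>f\<close> vanish at \<open>\<xi>\<close> and write \<open>\<Delta>\<^sup>k f(\<xi>) = p\<^sup>k a\<^sub>k\<close>. Newton's formula and
  \<open>k (h choose k) = h (h - 1 choose k - 1)\<close> give, for every natural number \<open>i\<close>,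
  \<open>f (\<xi> + i + 1) = p (i + 1) Q(i)\<close> where \<open>Q(i)\<close> is the sum of \<open>(i choose j) b\<^sub>j\<close> and
  \<open>b\<^sub>j = p\<^sup>j a\<^sub>j\<^sub>+\<^sub>1 / (j + 1)\<close>. The \<open>b\<^sub>j\<close> are p-adic integers tending to \<open>0\<close>, so \<open>Q\<close> extends
  continuously to the p-adic integers, and all \<open>b\<^sub>j\<close> with \<open>j \<ge> 1\<close> are divisible by \<open>p\<close> (for
  \<open>p = 2\<close>, \<open>j = 1\<close> this is the extra condition on \<open>\<Delta>\<^sub>f(2)\<close>). Hence \<open>f(s) = p (s - \<xi>) G(s)\<close> with
  \<open>G\<close> continuous and congruent to \<open>\<Delta>\<^sub>f\<close>. For a product of \<open>n\<close> such functions one gets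
  \<open>F = p\<^sup>n L\<close>, where \<open>L\<close> is modulo \<open>p\<close> a constant times a monic polynomial of degree \<open>n\<close>, whose
  \<open>n\<close>-th difference is \<open>n!\<close>.
\<close>

section \<open>Divisibility and continuity in the p-adic integers\<close>

lemma padic_p_neq_0 [simp]: "(padic_p :: 'p::prime_card padic_int) \<noteq> 0"
proof
  assume *: "(padic_p :: 'p padic_int) = 0"
  have p1: "int CARD('p) > 1"
    using prime_card[where 'a = 'p] prime_gt_1_nat by auto
  \<comment> \<open>Entry 2 is the first one that separates p from 0, since p mod p = 0 already at
    entry 1.\<close>
  have "padic_rep (padic_p :: 'p padic_int) 2 = int CARD('p) mod int CARD('p) ^ 2"
    by (rule padic_rep_of_nat)
  also have "\<dots> = int CARD('p)"
    using p1 by (simp add: power2_eq_square)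
  finally show False
    using * p1 by (simp add: zero_padic_int.rep_eq)
qed

lemma padic_eqI_dvd:
  assumes "\<And>m. padic_p ^ m dvd (x - y :: 'p::prime_card padic_int)"
  shows "x = y"
  using assms by (intro padic_int_eqI) (simp add: padic_rep_eq_iff_dvd)

lemma padic_p_dvd_of_nat_iff: "(padic_p :: 'p::prime_card padic_int) dvd of_nat u \<longleftrightarrow> CARD('p) dvd u"
  using padic_rep_eq_0_iff[of "of_nat u :: 'p padic_int" 1]
  by (simp add: padic_rep_of_nat flip: of_nat_mod dvd_eq_mod_eq_0)

text \<open>The entry \<open>padic_rep x m\<close> is itself a nonnegative integer and serves as the
  approximation. This density of the naturals lets continuous functions be controlled by their
  values there.\<close>

lemma padic_nat_approx:
  obtains i where "padic_p ^ m dvd (x - of_nat i :: 'p::prime_card padic_int)"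
proof
  have "padic_rep x m = padic_rep x m mod int CARD('p) ^ m"
    by (simp add: padic_rep_mod)
  moreover have "int CARD('p) ^ m > 0"
    by simp
  ultimately have "padic_rep x m \<ge> 0"
    by (metis pos_mod_sign)
  then have "padic_rep x m = padic_rep (of_nat (nat (padic_rep x m)) :: 'p padic_int) m"
    unfolding padic_rep_of_nat by (simp add: padic_rep_mod)
  then show "padic_p ^ m dvd (x - of_nat (nat (padic_rep x m)))"
    by (simp add: padic_rep_eq_iff_dvd)
qed

text \<open>If p does not divide \<open>x\<close>, every entry is invertible modulo its power of p;
  inverses are unique there, so they form a compatible sequence, which is the inverse of
  \<open>x\<close>.\<close>

lemma padic_unit_iff: "x \<in> padic_units \<longleftrightarrow> \<not> padic_p dvd (x :: 'p::prime_card padic_int)"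
proof
  assume "x \<in> padic_units"
  then have "x dvd 1" by (simp add: padic_units_def)
  moreover have "\<not> (padic_p :: 'p padic_int) dvd 1"
    using padic_p_dvd_of_nat_iff[of 1, where 'p = 'p] prime_card[where 'a = 'p]
    by (auto simp: prime_nat_iff)
  ultimately show "\<not> padic_p dvd x" by (meson dvd_trans)
next
  let ?p = "int CARD('p)"
  assume nd: "\<not> padic_p dvd x"
  have nz: "padic_rep x 1 \<noteq> 0"
    using padic_rep_eq_0_iff[of x 1] nd by simp
  have cop: "coprime (padic_rep x n) (?p ^ n)" for n
  proof (cases n)
    case (Suc k)
    then have "padic_rep x n mod ?p \<noteq> 0"
      using padic_rep_mod[of 1 n x] nz by simp
    then have "coprime ?p (padic_rep x n)"
      by (intro prime_imp_coprime prime_card_int) (auto simp: dvd_eq_mod_eq_0)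
    then show ?thesis by (simp add: coprime_commute)
  qed auto
  have "\<exists>z. padic_rep x n * z mod ?p ^ n = 1 mod ?p ^ n" for n
    using cong_solve_coprime_int[OF cop] by (simp add: cong_def)
  then obtain z where z: "padic_rep x n * z n mod ?p ^ n = 1 mod ?p ^ n" for n
    by metis
  \<comment> \<open>Reduction yields the canonical representatives that the type demands; cancelling
    the unit \<open>padic_rep x n\<close> then gives compatibility.\<close>
  define y where "y = (\<lambda>n. z n mod ?p ^ n)"
  have y: "[padic_rep x n * y n = 1] (mod ?p ^ n)" for n
    using z[of n] by (simp add: y_def cong_def mod_simps)
  have "y (Suc n) mod ?p ^ n = y n" for n
  proof -
    have "[padic_rep x (Suc n) * y (Suc n) = 1] (mod ?p ^ n)"
      using y[of "Suc n"] by (rule cong_dvd_modulus) simp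
    moreover have "[padic_rep x (Suc n) * y (Suc n) = padic_rep x n * y (Suc n)] (mod ?p ^ n)"
      by (intro cong_mult cong_refl) (simp add: cong_def padic_rep_Suc_mod padic_rep_mod)
    ultimately have "[padic_rep x n * y (Suc n) = padic_rep x n * y n] (mod ?p ^ n)"
      using y[of n] by (meson cong_sym cong_trans)
    then have "[y (Suc n) = y n] (mod ?p ^ n)"
      using cop[of n] by (simp add: cong_mult_lcancel)
    then show ?thesis by (simp add: cong_def y_def)
  qed
  then have rep: "padic_rep (Abs_padic_int y :: 'p padic_int) = y"
    by (simp add: Abs_padic_int_inverse)
  have "x * Abs_padic_int y = 1"
    by (rule padic_int_eqI)
      (use y in \<open>simp add: times_padic_int.rep_eq one_padic_int.rep_eq rep cong_def\<close>)
  then show "x \<in> padic_units"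
    by (metis dvd_triv_left mem_Collect_eq padic_units_def)
qed

section \<open>Metric and continuity in terms of divisibility\<close>

lemma padic_dist_le_iff:
  "dist x y \<le> 1 / real CARD('p) ^ m \<longleftrightarrow> padic_p ^ m dvd (x - y :: 'p::prime_card padic_int)"
proof (cases "x = y")
  case False
  have p1: "real CARD('p) > 1"
    using prime_card[where 'a = 'p] prime_gt_1_nat by auto
  obtain k where k: "padic_ord (x - y) = enat k"
    using False padic_ord_eq_infinity_iff[of "x - y"] by auto
  have "dist x y \<le> 1 / real CARD('p) ^ m \<longleftrightarrow> real CARD('p) ^ m \<le> real CARD('p) ^ k"
    using False p1 by (simp add: dist_padic_int_def k field_simps)
  also have "\<dots> \<longleftrightarrow> m \<le> k"
    using p1 by (rule power_increasing_iff)
  also have "\<dots> \<longleftrightarrow> padic_p ^ m dvd (x - y)"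
    using le_padic_ord_iff[of m "x - y"] by (simp add: k)
  finally show ?thesis .
qed simp

text \<open>The radii 1 / p^m become arbitrarily small, so they suffice on both sides of the
  epsilon-delta condition, and closed balls of these radii are cosets of p^m.\<close>

lemma padic_continuous_iff:
  fixes g :: "'p::prime_card padic_int \<Rightarrow> 'p padic_int"
  shows "continuous_on UNIV g \<longleftrightarrow>
    (\<forall>x m. \<exists>M. \<forall>y. padic_p ^ M dvd (y - x) \<longrightarrow> padic_p ^ m dvd (g y - g x))"
proof
  have p1: "real CARD('p) > 1"
    using prime_card[where 'a = 'p] prime_gt_1_nat by auto
  have small: "\<exists>m. 1 / real CARD('p) ^ m < e" if "e > 0" for e
    using real_arch_pow_inv[of e "1 / real CARD('p)"] that p1 by (auto simp: power_divide)
  have pos: "1 / real CARD('p) ^ m > 0" for m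
    using p1 by simp
  {
    assume c: "continuous_on UNIV g"
    show "\<forall>x m. \<exists>M. \<forall>y. padic_p ^ M dvd (y - x) \<longrightarrow> padic_p ^ m dvd (g y - g x)"
    proof (intro allI)
      fix x m
      obtain d where d: "d > 0" "\<And>y. dist y x < d \<Longrightarrow> dist (g y) (g x) < 1 / real CARD('p) ^ m"
        using c pos[of m] unfolding continuous_on_iff by (metis UNIV_I)
      obtain M where M: "1 / real CARD('p) ^ M < d"
        using small d(1) by blast
      show "\<exists>M. \<forall>y. padic_p ^ M dvd (y - x) \<longrightarrow> padic_p ^ m dvd (g y - g x)"
      proof (intro exI allI impI)
        fix y assume "padic_p ^ M dvd (y - x)"
        then have "dist y x < d"
          using M unfolding padic_dist_le_iff[symmetric] by linarith
        from d(2)[OF this] show "padic_p ^ m dvd (g y - g x)"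
          unfolding padic_dist_le_iff[symmetric] by simp
      qed
    qed
  }
  {
    assume c: "\<forall>x m. \<exists>M. \<forall>y. padic_p ^ M dvd (y - x) \<longrightarrow> padic_p ^ m dvd (g y - g x)"
    show "continuous_on UNIV g"
      unfolding continuous_on_iff
    proof (intro ballI allI impI)
      fix x and e :: real
      assume "0 < e"
      then obtain m where m: "1 / real CARD('p) ^ m < e"
        using small by blast
      obtain M where M: "\<And>y. padic_p ^ M dvd (y - x) \<Longrightarrow> padic_p ^ m dvd (g y - g x)"
        using c by blast
      show "\<exists>d>0. \<forall>x'\<in>UNIV. dist x' x < d \<longrightarrow> dist (g x') (g x) < e"
      proof (intro exI conjI ballI impI)
        show "1 / real CARD('p) ^ M > 0" by (rule pos)
        fix y assume "dist y x < 1 / real CARD('p) ^ M"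
        then have "padic_p ^ M dvd (y - x)"
          unfolding padic_dist_le_iff[symmetric] by simp
        from M[OF this] show "dist (g y) (g x) < e"
          using m unfolding padic_dist_le_iff[symmetric] by linarith
      qed
    qed
  }
qed

lemma dvd_mult_diff:
  fixes a :: "'a::comm_ring_1"
  assumes "q dvd a - a'" "q dvd b - b'"
  shows "q dvd a * b - a' * b'"
proof -
  have "a * b - a' * b' = (a - a') * b + a' * (b - b')"
    by (simp add: algebra_simps)
  with assms show ?thesis by simp
qed

lemma dvd_prod_diff:
  fixes a :: "'i \<Rightarrow> 'a::comm_ring_1"
  assumes "\<And>i. i \<in> A \<Longrightarrow> q dvd a i - a' i"
  shows "q dvd prod a A - prod a' A"
  using assms
  by (induction A rule: infinite_finite_induct) (auto intro!: dvd_mult_diff)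

lemma padic_continuous_mult:
  fixes g h :: "'p::prime_card padic_int \<Rightarrow> 'p padic_int"
  assumes "continuous_on UNIV g" "continuous_on UNIV h"
  shows "continuous_on UNIV (\<lambda>s. g s * h s)"
  unfolding padic_continuous_iff
proof (intro allI)
  fix x m
  obtain M N where "\<And>y. padic_p ^ M dvd (y - x) \<Longrightarrow> padic_p ^ m dvd (g y - g x)"
    "\<And>y. padic_p ^ N dvd (y - x) \<Longrightarrow> padic_p ^ m dvd (h y - h x)"
    using assms unfolding padic_continuous_iff by metis
  moreover have "padic_p ^ M dvd z" "padic_p ^ N dvd z"
    if "padic_p ^ max M N dvd z" for z :: "'p padic_int"
    using that by (meson dvd_trans le_imp_power_dvd max.cobounded1 max.cobounded2)+
  ultimately show "\<exists>M. \<forall>y. padic_p ^ M dvd (y - x) \<longrightarrow> padic_p ^ m dvd (g y * h y - g x * h x)"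
    by (metis dvd_mult_diff)
qed

lemma padic_continuous_diff:
  fixes g h :: "'p::prime_card padic_int \<Rightarrow> 'p padic_int"
  assumes "continuous_on UNIV g" "continuous_on UNIV h"
  shows "continuous_on UNIV (\<lambda>s. g s - h s)"
  unfolding padic_continuous_iff
proof (intro allI)
  fix x m
  obtain M N where MN: "\<And>y. padic_p ^ M dvd (y - x) \<Longrightarrow> padic_p ^ m dvd (g y - g x)"
    "\<And>y. padic_p ^ N dvd (y - x) \<Longrightarrow> padic_p ^ m dvd (h y - h x)"
    using assms unfolding padic_continuous_iff by metis
  have "padic_p ^ M dvd z" "padic_p ^ N dvd z"
    if "padic_p ^ max M N dvd z" for z :: "'p padic_int"
    using that by (meson dvd_trans le_imp_power_dvd max.cobounded1 max.cobounded2)+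
  then have "padic_p ^ m dvd (g y - h y - (g x - h x))" if "padic_p ^ max M N dvd (y - x)" for y
    using dvd_diff[OF MN(1) MN(2), of y y] that by (simp add: algebra_simps)
  then show "\<exists>M. \<forall>y. padic_p ^ M dvd (y - x) \<longrightarrow> padic_p ^ m dvd (g y - h y - (g x - h x))"
    by blast
qed

lemma padic_continuous_shift:
  fixes g :: "'p::prime_card padic_int \<Rightarrow> 'p padic_int"
  assumes "continuous_on UNIV g"
  shows "continuous_on UNIV (\<lambda>s. g (s + c))"
  unfolding padic_continuous_iff
proof (intro allI)
  fix x m
  obtain M where M: "\<And>y. padic_p ^ M dvd (y - (x + c)) \<Longrightarrow> padic_p ^ m dvd (g y - g (x + c))"
    using assms unfolding padic_continuous_iff by blast
  have "padic_p ^ m dvd (g (y + c) - g (x + c))" if "padic_p ^ M dvd (y - x)" for y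
    using M[of "y + c"] that by simp
  then show "\<exists>M. \<forall>y. padic_p ^ M dvd (y - x) \<longrightarrow> padic_p ^ m dvd (g (y + c) - g (x + c))"
    by blast
qed

lemma padic_continuous_prod:
  fixes g :: "'i \<Rightarrow> 'p::prime_card padic_int \<Rightarrow> 'p padic_int"
  assumes "\<And>i. i \<in> A \<Longrightarrow> continuous_on UNIV (g i)"
  shows "continuous_on UNIV (\<lambda>s. \<Prod>i\<in>A. g i s)"
  using assms
  by (induction A rule: infinite_finite_induct)
    (auto intro!: padic_continuous_mult continuous_on_const)

text \<open>Divisibility by p^m passes to limits and the naturals are dense. Applied to a difference
  for every m, this also shows that continuous functions agreeing on the naturals are equal.\<close>

lemma padic_continuous_dvd:
  fixes g :: "'p::prime_card padic_int \<Rightarrow> 'p padic_int"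
  assumes "continuous_on UNIV g" "\<And>i. padic_p ^ m dvd g (of_nat i)"
  shows "padic_p ^ m dvd g x"
proof -
  obtain M where M: "\<And>y. padic_p ^ M dvd (y - x) \<Longrightarrow> padic_p ^ m dvd (g y - g x)"
    using assms(1) unfolding padic_continuous_iff by blast
  obtain i where "padic_p ^ M dvd (x - of_nat i)"
    by (rule padic_nat_approx)
  then have "padic_p ^ m dvd (g (of_nat i) - g x)"
    by (intro M) (metis dvd_minus_iff minus_diff_eq)
  then have "padic_p ^ m dvd (g (of_nat i) - (g (of_nat i) - g x))"
    using assms(2) by (rule dvd_diff[rotated])
  then show ?thesis by simp
qed

text \<open>The hypothesis is uniform continuity on the naturals. Entry m of the extension at
  \<open>x\<close> is read off from \<open>Q\<close> at a natural number close to \<open>x\<close>,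
  so completeness is built into the inverse limit.\<close>

lemma padic_continuous_extension:
  fixes Q :: "nat \<Rightarrow> 'p::prime_card padic_int"
  assumes "\<And>m. \<exists>M. \<forall>i j. padic_p ^ M dvd (of_nat i - of_nat j :: 'p padic_int) \<longrightarrow>
             padic_p ^ m dvd (Q i - Q j)"
  obtains G :: "'p padic_int \<Rightarrow> 'p padic_int"
    where "continuous_on UNIV G" "\<And>i. G (of_nat i) = Q i"
proof -
  obtain M where M: "padic_p ^ M m dvd (of_nat i - of_nat j :: 'p padic_int) \<Longrightarrow>
      padic_p ^ m dvd (Q i - Q j)" for m i j
    using assms by metis
  define r where "r = (\<lambda>(x :: 'p padic_int) k. SOME i. padic_p ^ k dvd (x - of_nat i))"
  have r: "padic_p ^ k dvd (x - of_nat (r x k))" for x k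
    unfolding r_def by (rule padic_nat_approx) (rule someI)
  \<comment> \<open>The modulus \<open>M\<close> need not be monotone; a precision of at least both \<open>M m\<close> and \<open>M (Suc m)\<close>
    makes consecutive approximations compatible.\<close>
  define R where "R = (\<lambda>x m. r x (M m + M (Suc m)))"
  define y where "y = (\<lambda>x m. padic_rep (Q (R x m)) m)"
  \<comment> \<open>\<open>Q\<close> modulo p^m depends only on the argument up to precision
    \<open>M m\<close>, so the arbitrary choice in \<open>r\<close> does no harm.\<close>
  have near: "padic_p ^ m dvd (Q i - Q (R x m))"
    if "padic_p ^ M m dvd (x - of_nat i)" for x i m
  proof (rule M)
    have "padic_p ^ M m dvd (x - of_nat (R x m))"
      using r[of "M m + M (Suc m)" x] unfolding R_def power_add by (rule dvd_mult_left)
    from dvd_diff[OF this that]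
    show "padic_p ^ M m dvd (of_nat i - of_nat (R x m) :: 'p padic_int)" by simp
  qed
  have compat: "y x (Suc m) mod int CARD('p) ^ m = y x m" for x m
  proof -
    have "padic_p ^ M m dvd (x - of_nat (R x (Suc m)))
        \<or> padic_p ^ M (Suc m) dvd (x - of_nat (R x m))"
      using r[of "M m + M (Suc m)" x] unfolding R_def power_add by (metis dvd_mult_right)
    moreover have "padic_p ^ m dvd (Q (R x (Suc m)) - Q (R x m))"
      if "padic_p ^ M m dvd (x - of_nat (R x (Suc m)))"
      using near that by blast
    moreover have "padic_p ^ m dvd (Q (R x (Suc m)) - Q (R x m))"
      if "padic_p ^ M (Suc m) dvd (x - of_nat (R x m))"
    proof -
      have "padic_p ^ Suc m dvd (Q (R x m) - Q (R x (Suc m)))"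
        using near that by blast
      then have "padic_p ^ m dvd (Q (R x m) - Q (R x (Suc m)))"
        by (metis dvd_trans le_imp_power_dvd le_SucI order_refl)
      then show ?thesis by (metis dvd_minus_iff minus_diff_eq)
    qed
    ultimately have "padic_p ^ m dvd (Q (R x (Suc m)) - Q (R x m))" by blast
    then show ?thesis
      unfolding y_def by (simp add: padic_rep_Suc_mod flip: padic_rep_eq_iff_dvd)
  qed
  define G :: "'p padic_int \<Rightarrow> 'p padic_int" where "G = (\<lambda>x. Abs_padic_int (y x))"
  have rep: "padic_rep (G x) = y x" for x
    unfolding G_def by (rule Abs_padic_int_inverse) (simp add: compat)
  have approx: "padic_p ^ m dvd (Q i - G x)" if "padic_p ^ M m dvd (x - of_nat i)" for x i m
  proof -
    have "padic_rep (G x) m = padic_rep (Q (R x m)) m"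
      by (simp add: rep y_def)
    with near[OF that] show ?thesis
      by (simp flip: padic_rep_eq_iff_dvd)
  qed
  show thesis
  proof (rule that[of G])
    show "G (of_nat i) = Q i" for i
      by (rule padic_eqI_dvd[symmetric]) (simp add: approx)
    show "continuous_on UNIV G"
      unfolding padic_continuous_iff
    proof (intro allI)
      fix x m
      have "padic_p ^ m dvd (G z - G x)" if "padic_p ^ M m dvd (z - x)" for z
      proof -
        obtain i where i: "padic_p ^ M m dvd (z - of_nat i)"
          by (rule padic_nat_approx)
        from dvd_diff[OF i that] have "padic_p ^ M m dvd (x - of_nat i)"
          by simp
        from dvd_diff[OF approx[OF this] approx[OF i]] show ?thesis by simp
      qed
      then show "\<exists>M. \<forall>y. padic_p ^ M dvd (y - x) \<longrightarrow> padic_p ^ m dvd (G y - G x)"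
        by blast
    qed
  qed
qed

section \<open>Forward differences\<close>

text \<open>Pascal's rule under the sum. With signed values of f as \<open>D\<close> it gives the
  recursion for differences, with differences as \<open>D\<close> the induction step of Newton's
  formula.\<close>

lemma binomial_sum_Suc:
  fixes D :: "nat \<Rightarrow> 'a::comm_ring_1"
  shows "(\<Sum>k\<le>Suc n. of_nat (Suc n choose k) * D k) =
    (\<Sum>k\<le>n. of_nat (n choose k) * (D k + D (Suc k)))"
proof -
  have "(\<Sum>k\<le>Suc n. of_nat (Suc n choose k) * D k) =
      (D 0 + (\<Sum>k\<le>n. of_nat (n choose Suc k) * D (Suc k))) + (\<Sum>k\<le>n. of_nat (n choose k) * D (Suc k))"
    by (subst sum.atMost_Suc_shift) (simp add: algebra_simps sum.distrib)
  also have "D 0 + (\<Sum>k\<le>n. of_nat (n choose Suc k) * D (Suc k)) =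
      (\<Sum>k\<le>Suc n. of_nat (n choose k) * D k)"
    using sum.atMost_Suc_shift[of "\<lambda>k. of_nat (n choose k) * D k" n]
    by (simp del: sum.atMost_Suc)
  also have "\<dots> = (\<Sum>k\<le>n. of_nat (n choose k) * D k)"
    by (simp add: binomial_eq_0)
  finally show ?thesis by (simp add: algebra_simps sum.distrib)
qed

text \<open>Removes the truncated exponent n - k, bringing the sum into the shape of
  \<open>binomial_sum_Suc\<close>.\<close>

lemma fwd_diff_alt:
  "fwd_diff n f s = (- 1) ^ n * (\<Sum>k\<le>n. of_nat (n choose k) * ((- 1) ^ k * f (s + of_nat k)))"
proof -
  have "(- 1) ^ (n - k) = (- 1) ^ n * (- 1 :: 'a padic_int) ^ k" if "k \<le> n" for k
    using that by (simp add: minus_one_power_iff)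
  then show ?thesis
    unfolding fwd_diff_def sum_distrib_left atLeast0AtMost
    by (intro sum.cong) (simp_all add: algebra_simps)
qed

lemma fwd_diff_0 [simp]: "fwd_diff 0 f s = f s"
  by (simp add: fwd_diff_def)

lemma fwd_diff_Suc: "fwd_diff (Suc n) f s = fwd_diff n f (s + 1) - fwd_diff n f s"
  unfolding fwd_diff_alt binomial_sum_Suc
  by (simp add: algebra_simps sum.distrib sum_distrib_left sum_subtractf sum_negf)

text \<open>A shift by one is the identity plus the difference operator. The induction moves the
  base point, which is why \<open>t\<close> is arbitrary.\<close>

lemma newton_forward: "f (t + of_nat h) = (\<Sum>k\<le>h. of_nat (h choose k) * fwd_diff k f t)"
proof (induction h arbitrary: t)
  case (Suc h)
  have "f (t + of_nat (Suc h)) = f ((t + 1) + of_nat h)"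
    by (simp add: algebra_simps)
  also have "\<dots> = (\<Sum>k\<le>h. of_nat (h choose k) * fwd_diff k f (t + 1))"
    by (rule Suc.IH)
  also have "\<dots> = (\<Sum>k\<le>h. of_nat (h choose k) * (fwd_diff k f t + fwd_diff (Suc k) f t))"
    by (simp add: fwd_diff_Suc)
  finally show ?case by (simp only: binomial_sum_Suc)
qed simp

lemma fwd_diff_cmult: "fwd_diff n (\<lambda>s. c * g s) s = c * fwd_diff n g s"
  unfolding fwd_diff_def by (simp add: sum_distrib_left algebra_simps)

lemma fwd_diff_cong_dvd:
  assumes "\<And>s. q dvd g s - h s"
  shows "q dvd fwd_diff n g s - fwd_diff n h s"
proof -
  have "fwd_diff n g s - fwd_diff n h s =
      (\<Sum>\<nu>=0..n. of_nat (n choose \<nu>) * (- 1) ^ (n - \<nu>) * (g (s + of_nat \<nu>) - h (s + of_nat \<nu>)))"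
    unfolding fwd_diff_def by (simp add: sum_subtractf algebra_simps)
  also have "q dvd \<dots>"
    using assms by (intro dvd_sum dvd_mult)
  finally show ?thesis .
qed

text \<open>Leibniz rule: second and higher differences of the linear factor vanish, so two terms
  remain.\<close>

lemma fwd_diff_Suc_linear_mult:
  "fwd_diff (Suc n) (\<lambda>s. (s - c) * g s) s =
    (s - c) * fwd_diff (Suc n) g s + of_nat (Suc n) * fwd_diff n g (s + 1)"
proof (induction n arbitrary: s)
  case 0
  show ?case by (simp add: fwd_diff_Suc algebra_simps)
next
  case (Suc n)
  show ?case
    by (subst fwd_diff_Suc, subst (1 2) Suc.IH)
      (simp add: fwd_diff_Suc[of "Suc n"] fwd_diff_Suc[of n] algebra_simps)
qed

text \<open>Inductively the shorter product has a constant n-th difference, hence a vanishing next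
  one, and the Leibniz rule leaves only (n + 1) n!.\<close>

lemma fwd_diff_prod_linear: "fwd_diff n (\<lambda>s. \<Prod>i=1..n. s - c i) s = of_nat (fact n)"
proof (induction n arbitrary: s)
  case (Suc n)
  have "fwd_diff (Suc n) (\<lambda>s. \<Prod>i=1..n. s - c i) s = 0"
    unfolding fwd_diff_Suc Suc.IH by simp
  then show ?case
    using fwd_diff_Suc_linear_mult[of n "c (Suc n)" "\<lambda>s. \<Prod>i=1..n. s - c i" s] Suc.IH
    by (simp add: algebra_simps del: One_nat_def)
qed simp

lemma continuous_fwd_diff:
  fixes f :: "'p::prime_card padic_int \<Rightarrow> 'p padic_int"
  assumes "continuous_on UNIV f"
  shows "continuous_on UNIV (fwd_diff n f)"
proof (induction n)
  case 0
  then show ?case using assms by (simp cong: continuous_on_cong)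
next
  case (Suc n)
  from padic_continuous_diff[OF padic_continuous_shift[OF Suc, of 1] Suc]
  show ?case by (simp add: fwd_diff_Suc cong: continuous_on_cong)
qed

section \<open>Kummer spaces\<close>

lemma kummer_coeff_eqI:
  assumes "fwd_diff k f 0 = padic_p ^ k * d"
  shows "kummer_coeff f k = (d :: 'p::prime_card padic_int)"
  unfolding kummer_coeff_def using assms by (intro the_equality) auto

text \<open>Justifies the definite description: the only candidate is entry 1 of the
  coefficient.\<close>

lemma kummer_residue_cong:
  "padic_cong (of_nat (kummer_residue f)) (kummer_coeff f 1)"
  "kummer_residue (f :: 'p::prime_card padic_int \<Rightarrow> _) < CARD('p)"
proof -
  let ?P = "\<lambda>d. d < CARD('p) \<and> padic_cong (of_nat d) (kummer_coeff f 1)"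
  have iff: "padic_cong (of_nat d) x \<longleftrightarrow> int d mod int CARD('p) = padic_rep x 1"
    for d and x :: "'p padic_int"
    using padic_rep_eq_iff_dvd[of "of_nat d" 1 x] by (simp add: padic_cong_def padic_rep_of_nat)
  let ?x = "padic_rep (kummer_coeff f 1) 1"
  have x: "?x mod int CARD('p) = ?x"
    using padic_rep_mod[of 1 1] by simp
  then have range: "0 \<le> ?x" "?x < int CARD('p)"
    by (metis pos_mod_sign pos_mod_bound of_nat_0_less_iff zero_less_card_finite)+
  have "\<exists>!d. ?P d"
  proof
    show "?P (nat ?x)"
      unfolding iff using range x by simp
    show "d = nat ?x" if "?P d" for d
    proof -
      have "int d = ?x"
        using that unfolding iff by auto
      then show ?thesis by simp
    qed
  qed
  from theI'[OF this] show "padic_cong (of_nat (kummer_residue f)) (kummer_coeff f 1)"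
    "kummer_residue f < CARD('p)"
    unfolding kummer_residue_def by auto
qed

text \<open>Neighbouring k-th differences differ by a (k + 1)-st one, which p^(k+1) divides;
  continuity extends this from the naturals. It allows the base point to move from 0 to a zero of
  f.\<close>

lemma kummer_fwd_diff_cong:
  fixes f :: "'p::prime_card padic_int \<Rightarrow> 'p padic_int"
  assumes "f \<in> kummer_space2"
  shows "padic_p ^ Suc k dvd (fwd_diff k f s - fwd_diff k f 0)"
proof (rule padic_continuous_dvd[where g = "\<lambda>s. fwd_diff k f s - fwd_diff k f 0"])
  show "continuous_on UNIV (\<lambda>s. fwd_diff k f s - fwd_diff k f 0)"
    using assms by (intro padic_continuous_diff continuous_fwd_diff continuous_on_const)
      (simp add: kummer_space2_def)
  show "padic_p ^ Suc k dvd (fwd_diff k f (of_nat i) - fwd_diff k f 0)" for i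
  proof (induction i)
    case (Suc i)
    have "padic_p ^ Suc k dvd fwd_diff (Suc k) f (of_nat i)"
      using assms unfolding kummer_space2_def by blast
    from dvd_add[OF this Suc] show ?case
      by (simp add: fwd_diff_Suc algebra_simps)
  qed simp
qed

section \<open>Decay of p^j / (j + 1) and continuity of binomial series\<close>

lemma two_mult_le_prime_power:
  assumes "(p::nat) \<ge> 2" shows "2 * v \<le> p ^ v"
proof -
  have "2 * v \<le> 2 ^ v"
  proof (induction v)
    case (Suc v)
    then show ?case by (cases v) auto
  qed simp
  also have "\<dots> \<le> p ^ v" using assms by (intro power_mono) auto
  finally show ?thesis .
qed

text \<open>Ensures that a factor p survives in p^j / (j + 1). The case p = 2, j = 1 is a genuine
  exception, as 2 / 2 = 1.\<close>

lemma Suc_le_of_prime_power: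
  assumes "p \<ge> 2" "p ^ v \<le> Suc j" "j \<ge> 1" "p \<noteq> 2 \<or> j \<ge> 2"
  shows "Suc v \<le> (j::nat)"
proof (cases "p = 2")
  case True
  have "v + 2 \<le> 2 ^ v" if "v \<ge> 2"
    using that by (induction v rule: dec_induct) auto
  moreover have "v < 2 \<Longrightarrow> Suc v \<le> j"
    using assms True by linarith
  ultimately show ?thesis using assms True by (cases "v \<ge> 2") auto
next
  case False
  have "2 * v + 1 \<le> 3 ^ v" by (induction v) auto
  also have "\<dots> \<le> p ^ v" using assms False by (intro power_mono) auto
  finally show ?thesis using assms by linarith
qed

lemma padic_of_nat_decompose:
  assumes "n > 0"
  obtains v and u w :: "'p::prime_card padic_int"
    where "of_nat n = padic_p ^ v * u" "u * w = 1" "CARD('p) ^ v \<le> n"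
proof -
  obtain k where k: "n = CARD('p) ^ multiplicity CARD('p) n * k" "\<not> CARD('p) dvd k"
    using assms prime_card[where 'a = 'p]
    by (metis multiplicity_decompose' not_prime_unit not_gr_zero)
  have "(of_nat k :: 'p padic_int) \<in> padic_units"
    using k(2) by (simp add: padic_unit_iff padic_p_dvd_of_nat_iff)
  then obtain w where "of_nat k * w = (1 :: 'p padic_int)"
    by (auto simp: padic_units_def elim!: dvdE)
  moreover have "of_nat n = padic_p ^ multiplicity CARD('p) n * (of_nat k :: 'p padic_int)"
    by (subst k(1)) simp
  moreover have "CARD('p) ^ multiplicity CARD('p) n \<le> n"
    using assms by (intro dvd_imp_le multiplicity_dvd)
  ultimately show thesis using that by blast
qed

text \<open>Since p^v <= j + 1 forces 2 v <= j + 1, at least (j - 1) / 2 factors of p survive the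
  division. The second clause yields convergence to 0, the third the vanishing modulo p.\<close>

lemma padic_power_div_Suc:
  fixes a :: "'p::prime_card padic_int"
  obtains b where "padic_p ^ j * a = of_nat (Suc j) * b"
    "\<And>m. 2 * m + 1 \<le> j \<Longrightarrow> padic_p ^ m dvd b"
    "\<lbrakk>j \<ge> 1; CARD('p) \<noteq> 2 \<or> j \<ge> 2\<rbrakk> \<Longrightarrow> padic_p dvd b"
proof -
  obtain v and u w :: "'p padic_int" where
    uv: "of_nat (Suc j) = padic_p ^ v * u" "u * w = 1" "CARD('p) ^ v \<le> Suc j"
    by (rule padic_of_nat_decompose[of "Suc j"]) auto
  have p2: "CARD('p) \<ge> 2"
    using prime_card[where 'a = 'p] by (rule prime_ge_2_nat)
  have v2: "2 * v \<le> Suc j"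
    using two_mult_le_prime_power[OF p2, of v] uv(3) by linarith
  then have "v \<le> j" by linarith
  \<comment> \<open>The quotient by j + 1 = p^v \<open>u\<close>: p^v is cancelled and
    \<open>w\<close> inverts the unit part.\<close>
  let ?b = "padic_p ^ (j - v) * (a * w)"
  show thesis
  proof (rule that[of ?b])
    have "of_nat (Suc j) * ?b = (padic_p ^ v * padic_p ^ (j - v)) * a * (u * w)"
      unfolding uv(1) by (simp add: algebra_simps)
    also have "\<dots> = padic_p ^ j * a"
      using \<open>v \<le> j\<close> uv(2) by (simp flip: power_add)
    finally show "padic_p ^ j * a = of_nat (Suc j) * ?b" ..
    show "padic_p ^ m dvd ?b" if "2 * m + 1 \<le> j" for m
      using that v2 by (intro dvd_mult2 le_imp_power_dvd) linarith
    show "padic_p dvd ?b" if "j \<ge> 1" "CARD('p) \<noteq> 2 \<or> j \<ge> 2"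
      using Suc_le_of_prime_power[OF p2 uv(3) that] by (intro dvd_mult2) auto
  qed
qed

text \<open>The factor j! clears the denominators: the falling factorial is an integral polynomial
  in i and so respects congruences.\<close>

lemma binomial_padic_cong:
  fixes i i' :: nat
  assumes "q dvd (of_nat i - of_nat i' :: 'a::comm_ring_1)"
  shows "q dvd (of_nat (fact j * (i choose j)) - of_nat (fact j * (i' choose j)) :: 'a)"
proof (induction j)
  case (Suc j)
  have step: "of_nat (fact (Suc j) * (i choose Suc j)) =
      (of_nat i - of_nat j) * (of_nat (fact j * (i choose j)) :: 'a)" for i
  proof (cases "j \<le> i")
    case True
    have "Suc j * (i choose Suc j) = (i - j) * (i choose j)"
      using binomial_absorb_comp[of i j] Suc_times_binomial[of j "i - 1"]
      by (cases i) simp_all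
    then have "fact (Suc j) * (i choose Suc j) = (i - j) * (fact j * (i choose j))"
      by (metis fact_Suc mult.left_commute mult.commute of_nat_id)
    then show ?thesis using True by (simp only: of_nat_mult of_nat_diff)
  qed (simp add: binomial_eq_0)
  show ?case unfolding step
    using assms by (intro dvd_mult_diff Suc) simp
qed simp

text \<open>
  Modulo \<open>p\<^sup>m\<close> only the terms with \<open>j < J\<close> survive; multiplied by \<open>J!\<close> their binomial
  coefficients become integral polynomials in \<open>i\<close>, so precision \<open>v + m\<close> with \<open>v = ord\<^sub>p J!\<close>
  suffices.
\<close>

lemma mahler_uniformly_continuous:
  fixes b :: "nat \<Rightarrow> 'p::prime_card padic_int"
  assumes "\<And>m. \<exists>J. \<forall>j\<ge>J. padic_p ^ m dvd b j"
  shows "\<exists>M. \<forall>i i'. padic_p ^ M dvd (of_nat i - of_nat i' :: 'p padic_int) \<longrightarrow>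
    padic_p ^ m dvd ((\<Sum>j\<le>i. of_nat (i choose j) * b j) - (\<Sum>j\<le>i'. of_nat (i' choose j) * b j))"
proof -
  obtain J where J: "\<And>j. j \<ge> J \<Longrightarrow> padic_p ^ m dvd b j"
    using assms by blast
  obtain v and u w :: "'p padic_int" where
    uv: "of_nat (fact J) = padic_p ^ v * u" "u * w = 1"
    by (rule padic_of_nat_decompose[of "fact J"]) auto
  have main: "padic_p ^ m dvd ((\<Sum>j\<le>i. of_nat (i choose j) * b j) - (\<Sum>j\<le>i'. of_nat (i' choose j) * b j))"
    if ii: "padic_p ^ (v + m) dvd (of_nat i - of_nat i' :: 'p padic_int)" for i i'
  proof -
    \<comment> \<open>A common summation range for both sums; the added binomial coefficients are
      zero.\<close>
    have ext: "(\<Sum>j\<le>k. of_nat (k choose j) * b j) = (\<Sum>j\<le>i + i'. of_nat (k choose j) * b j)"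
      if "k \<le> i + i'" for k
      using that by (intro sum.mono_neutral_left) (auto simp: binomial_eq_0)
    have "padic_p ^ m dvd (of_nat (i choose j) - of_nat (i' choose j)) * b j" for j
    proof (cases "j \<ge> J")
      case False
      then obtain c where c: "(fact J :: nat) = fact j * c"
        using fact_dvd[of j J, where 'a = nat] by (auto elim: dvdE)
      have "padic_p ^ (v + m) dvd (of_nat (fact j * (i choose j)) - of_nat (fact j * (i' choose j)) :: 'p padic_int)"
        by (rule binomial_padic_cong[OF ii])
      \<comment> \<open>The factor \<open>c\<close> raises j! to J! = p^v \<open>u\<close> and
        \<open>w\<close> removes \<open>u\<close>; the remaining p^v is cancelled against the extra
        precision.\<close>
      then have "padic_p ^ (v + m) dvd of_nat c * w * (of_nat (fact j * (i choose j)) - of_nat (fact j * (i' choose j)) :: 'p padic_int)"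
        by (rule dvd_mult)
      also have "\<dots> = of_nat (fact J) * w * (of_nat (i choose j) - of_nat (i' choose j))"
        unfolding c by (simp add: algebra_simps)
      also have "\<dots> = padic_p ^ v * (u * w) * (of_nat (i choose j) - of_nat (i' choose j))"
        unfolding uv(1) by (simp add: algebra_simps)
      finally show ?thesis
        by (simp add: uv(2) power_add dvd_mult2)
    qed (simp add: J)
    then have "padic_p ^ m dvd (\<Sum>j\<le>i + i'. (of_nat (i choose j) - of_nat (i' choose j)) * b j)"
      by (intro dvd_sum)
    then show ?thesis
      using ext[of i] ext[of i'] by (simp add: sum_subtractf algebra_simps)
  qed
  then show ?thesis by blast
qed

section \<open>Factorisation of a single function at its zero\<close>

lemma kummer_W0_factor:
  fixes f :: "'p::prime_card padic_int \<Rightarrow> 'p padic_int"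
  assumes f: "f \<in> kummer_W0" and zero: "f \<xi> = 0"
  obtains G where "continuous_on UNIV G" "\<And>s. f s = padic_p * (s - \<xi>) * G s"
    "\<And>s. padic_p dvd (G s - of_nat (kummer_residue f))"
proof -
  have K: "f \<in> kummer_space2" and cont: "continuous_on UNIV f"
    and d: "\<And>k s. padic_p ^ k dvd fwd_diff k f s"
    using f by (auto simp: kummer_W0_def kummer_space2_def)
  have "\<forall>k. \<exists>a. fwd_diff k f \<xi> = padic_p ^ k * a"
    using d[of _ \<xi>] by (simp add: dvd_def)
  from choice[OF this] obtain a where a: "\<And>k. fwd_diff k f \<xi> = padic_p ^ k * a k"
    by blast
  have coeff: "fwd_diff k f 0 = padic_p ^ k * kummer_coeff f k" for k
    using d[of k 0] by (metis dvdE kummer_coeff_eqI)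
  \<comment> \<open>The congruence modulo p^(k+1) between the differences at \<open>\<xi>\<close>
    and 0, divided by p^k.\<close>
  have ac: "padic_p dvd (a k - kummer_coeff f k)" for k
    using kummer_fwd_diff_cong[OF K, of k \<xi>]
    by (simp add: a coeff power_Suc2 del: power_Suc flip: right_diff_distrib)
  have "\<exists>b. padic_p ^ j * a (Suc j) = of_nat (Suc j) * b \<and>
    (\<forall>m. 2 * m + 1 \<le> j \<longrightarrow> padic_p ^ m dvd b) \<and>
    (j \<ge> 1 \<longrightarrow> CARD('p) \<noteq> 2 \<or> j \<ge> 2 \<longrightarrow> padic_p dvd b)" for j
    by (rule padic_power_div_Suc[of j "a (Suc j)"]) blast
  then obtain b where b: "\<And>j. padic_p ^ j * a (Suc j) = of_nat (Suc j) * b j"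
    and b_small: "\<And>j m. 2 * m + 1 \<le> j \<Longrightarrow> padic_p ^ m dvd b j"
    and b_p: "\<And>j. j \<ge> 1 \<Longrightarrow> CARD('p) \<noteq> 2 \<or> j \<ge> 2 \<Longrightarrow> padic_p dvd b j"
    by metis
  have a0: "a 0 = 0" using a[of 0] zero by simp
  have b0: "b 0 = a 1" using b[of 0] by simp
  have b_dvd: "padic_p dvd b j" if "j \<ge> 1" for j
  proof (cases "CARD('p) = 2 \<and> j = 1")
    case True
    \<comment> \<open>In the exceptional case the defining equation reads 2 a_2 = 2 b_1, so the
      condition on the second coefficient supplies the missing factor 2.\<close>
    then have "padic_p * a 2 = padic_p * b 1"
      using b[of 1] by (simp only: numeral_2_eq_2 One_nat_def power_Suc power_0 mult_1_right)
    then have "a 2 = b 1"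
      by (rule mult_left_cancel[OF padic_p_neq_0, THEN iffD1])
    moreover have "padic_p dvd kummer_coeff f 2"
      using f True by (simp add: kummer_W0_def)
    then have "padic_p dvd a 2"
      using ac[of 2] by (metis diff_add_cancel dvd_add)
    ultimately show ?thesis using True by simp
  next
    case False
    then show ?thesis using b_p[OF that] that by linarith
  qed
  define Q where "Q = (\<lambda>i. \<Sum>j\<le>i. of_nat (i choose j) * b j)"
  have Q: "f (\<xi> + of_nat (Suc i)) = padic_p * of_nat (Suc i) * Q i" for i
  proof -
    have "f (\<xi> + of_nat (Suc i)) =
        (\<Sum>k\<le>i. of_nat (Suc i choose Suc k) * (padic_p * (padic_p ^ k * a (Suc k))))"
      unfolding newton_forward[of f \<xi>]
      by (subst sum.atMost_Suc_shift) (simp add: a a0 mult.assoc)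
    \<comment> \<open>The denominator k + 1 of \<open>b k\<close> moves to the binomial coefficient,
      where absorption trades it for the common factor i + 1.\<close>
    also have "\<dots> = (\<Sum>k\<le>i. padic_p * of_nat (Suc k * (Suc i choose Suc k)) * b k)"
      unfolding b by (intro sum.cong refl) (simp only: of_nat_mult ac_simps)
    also have "\<dots> = padic_p * of_nat (Suc i) * Q i"
      unfolding Q_def Suc_times_binomial sum_distrib_left
      by (intro sum.cong refl) (simp only: of_nat_mult ac_simps)
    finally show ?thesis .
  qed
  have "\<exists>J. \<forall>j\<ge>J. padic_p ^ m dvd b j" for m
    using b_small[of m] by blast
  then have "\<exists>M. \<forall>i j. padic_p ^ M dvd (of_nat i - of_nat j :: 'p padic_int) \<longrightarrow>
      padic_p ^ m dvd (Q i - Q j)" for m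
    unfolding Q_def by (rule mahler_uniformly_continuous)
  then obtain G :: "'p padic_int \<Rightarrow> 'p padic_int"
    where G: "continuous_on UNIV G" "\<And>i. G (of_nat i) = Q i"
    by (rule padic_continuous_extension) (rule that)
  have Q_cong: "padic_p dvd (Q i - of_nat (kummer_residue f))" for i
  proof -
    have "{..i} = insert 0 {1..i}" by auto
    then have "Q i = a 1 + (\<Sum>j=1..i. of_nat (i choose j) * b j)"
      unfolding Q_def by (simp add: b0)
    moreover have "padic_p dvd (\<Sum>j=1..i. of_nat (i choose j) * b j)"
      by (intro dvd_sum dvd_mult b_dvd) simp
    ultimately have "padic_p dvd (Q i - a 1)" by simp
    from dvd_diff[OF dvd_add[OF this ac[of 1]] kummer_residue_cong(1)[of f, unfolded padic_cong_def]]
    show ?thesis by (simp add: algebra_simps)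
  qed
  have G_cong: "padic_p dvd (G x - of_nat (kummer_residue f))" for x
  proof -
    have "padic_p ^ 1 dvd (G x - of_nat (kummer_residue f))"
    proof (rule padic_continuous_dvd[of "\<lambda>x. G x - of_nat (kummer_residue f)"])
      show "continuous_on UNIV (\<lambda>x. G x - of_nat (kummer_residue f))"
        by (rule padic_continuous_diff[OF G(1) continuous_on_const])
      show "padic_p ^ 1 dvd (G (of_nat i) - of_nat (kummer_residue f))" for i
        unfolding G(2) power_one_right by (rule Q_cong)
    qed
    then show ?thesis unfolding power_one_right .
  qed
  \<comment> \<open>\<open>Q i\<close> belongs to the argument \<open>\<xi> + i + 1\<close>, hence
    the offset by one. Both sides are continuous and agree on the naturals.\<close>
  have eq: "f (x + (\<xi> + 1)) = padic_p * (x + 1) * G x" for x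
  proof (rule padic_eqI_dvd)
    fix m
    \<comment> \<open>The form \<open>x - (- 1)\<close> makes the closure of continuity under
      differences applicable.\<close>
    let ?g = "\<lambda>x. f (x + (\<xi> + 1)) - padic_p * (x - (- 1)) * G x"
    have "continuous_on UNIV ?g"
      by (rule padic_continuous_diff[OF padic_continuous_shift[OF cont] padic_continuous_mult[OF
              padic_continuous_mult[OF continuous_on_const
                padic_continuous_diff[OF continuous_on_id continuous_on_const]] G(1)]])
    moreover have "?g (of_nat i) = 0" for i
      using Q[of i] unfolding G(2) by (simp add: add.commute add.left_commute)
    then have "padic_p ^ m dvd ?g (of_nat i)" for i
      by (simp only: dvd_0_right)
    ultimately have "padic_p ^ m dvd ?g x"
      by (rule padic_continuous_dvd[of ?g])
    then show "padic_p ^ m dvd (f (x + (\<xi> + 1)) - padic_p * (x + 1) * G x)"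
      by simp
  qed
  show thesis
  proof (rule that)
    show "continuous_on UNIV (\<lambda>s. G (s + (- \<xi> - 1)))"
      by (rule padic_continuous_shift) (rule G)
    show "f s = padic_p * (s - \<xi>) * G (s + (- \<xi> - 1))" for s
      using eq[of "s + (- \<xi> - 1)"] by simp
    show "padic_p dvd (G (s + (- \<xi> - 1)) - of_nat (kummer_residue f))" for s
      by (rule G_cong)
  qed
qed

text \<open>Treats the finite and infinite cases together, so that both claims about lambda become
  lower bounds at n and n + 1.\<close>

lemma enat_le_kummer_lambda_iff:
  "enat n \<le> kummer_lambda F \<longleftrightarrow> (\<forall>k<n. kummer_coeff F k \<notin> padic_units)"
proof (cases "\<exists>k. kummer_coeff F k \<in> padic_units")
  case True
  then have "kummer_coeff F (LEAST k. kummer_coeff F k \<in> padic_units) \<in> padic_units"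
    by (rule LeastI_ex)
  then have "(\<forall>k<n. kummer_coeff F k \<notin> padic_units) \<longleftrightarrow>
      n \<le> (LEAST k. kummer_coeff F k \<in> padic_units)"
    by (metis (no_types, lifting) not_less not_less_Least order_less_le_trans)
  then show ?thesis
    using True by (simp add: kummer_lambda_def)
qed (simp add: kummer_lambda_def)

section \<open>The product of n functions\<close>

theorem theorem6p12:
  fixes f :: "nat \<Rightarrow> 'p::prime_card padic_int \<Rightarrow> 'p padic_int"
    and F :: "'p padic_int \<Rightarrow> 'p padic_int"
    and \<xi> :: "nat \<Rightarrow> 'p padic_int"
    and n :: nat
  assumes "n \<ge> 1"
    and "\<And>\<nu>. \<nu> \<in> {1..n} \<Longrightarrow> f \<nu> \<in> kummer_W0"
    and "\<And>\<nu>. \<nu> \<in> {1..n} \<Longrightarrow> f \<nu> (\<xi> \<nu>) = 0"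
    and "F = (\<lambda>s. \<Prod>\<nu>=1..n. f \<nu> s)"
  shows "(\<exists>Fstar :: 'p padic_int \<Rightarrow> 'p padic_int.
            continuous_on UNIV Fstar \<and>
            (\<forall>s. Fstar s \<in> padic_units) \<and>
            (\<forall>s. F s = padic_p ^ n * (\<Prod>\<nu>=1..n. s - \<xi> \<nu>) * Fstar s) \<and>
            (\<forall>s. padic_cong (Fstar s) (of_nat (\<Prod>\<nu>=1..n. kummer_residue (f \<nu>))))) \<and>
         padic_cong (kummer_coeff F n) (of_nat (fact n * (\<Prod>\<nu>=1..n. kummer_residue (f \<nu>)))) \<and>
         (\<forall>\<nu>\<in>{0..n}. padic_ord (kummer_coeff F \<nu>) \<ge> enat (n - \<nu>)) \<and>
         (if n < CARD('p) then kummer_lambda F = enat n else kummer_lambda F > enat n)"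
proof -
  define c where "c = (\<Prod>\<nu>=1..n. kummer_residue (f \<nu>))"
  have "\<exists>G. continuous_on UNIV G \<and> (\<forall>s. f \<nu> s = padic_p * (s - \<xi> \<nu>) * G s) \<and>
      (\<forall>s. padic_p dvd (G s - of_nat (kummer_residue (f \<nu>))))" if "\<nu> \<in> {1..n}" for \<nu>
    using kummer_W0_factor[OF assms(2,3)[OF that]] by metis
  then obtain G where G: "\<And>\<nu>. \<nu> \<in> {1..n} \<Longrightarrow> continuous_on UNIV (G \<nu>)"
    and f: "\<And>\<nu> s. \<nu> \<in> {1..n} \<Longrightarrow> f \<nu> s = padic_p * (s - \<xi> \<nu>) * G \<nu> s"
    and G_cong: "\<And>\<nu> s. \<nu> \<in> {1..n} \<Longrightarrow> padic_p dvd (G \<nu> s - of_nat (kummer_residue (f \<nu>)))"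
    by metis
  define H where "H = (\<lambda>s. \<Prod>\<nu>=1..n. G \<nu> s)"
  have H_cont: "continuous_on UNIV H"
    unfolding H_def by (intro padic_continuous_prod G)
  have H_cong: "padic_p dvd (H s - of_nat c)" for s
    unfolding H_def c_def of_nat_prod by (intro dvd_prod_diff G_cong)
  have p: "prime CARD('p)" by (rule prime_card)
  have c: "\<not> CARD('p) dvd c"
  proof
    assume "CARD('p) dvd c"
    then obtain \<nu> where "\<nu> \<in> {1..n}" "CARD('p) dvd kummer_residue (f \<nu>)"
      unfolding c_def by (auto simp: prime_dvd_prod_iff[OF _ p])
    moreover from this(1) have "kummer_residue (f \<nu>) \<noteq> 0"
      using assms(2) by (auto simp: kummer_W0_def)
    \<comment> \<open>A nonzero residue lies strictly between 0 and p, so p cannot divide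
      it.\<close>
    ultimately show False
      using kummer_residue_cong(2)[of "f \<nu>"] by (meson nat_dvd_not_less not_gr_zero)
  qed
  have H_unit: "H s \<in> padic_units" for s
    using c H_cong[of s] dvd_diff[of padic_p "H s" "H s - of_nat c"]
    by (auto simp: padic_unit_iff padic_p_dvd_of_nat_iff)
  define L where "L = (\<lambda>s. (\<Prod>\<nu>=1..n. s - \<xi> \<nu>) * H s)"
  have F: "F = (\<lambda>s. padic_p ^ n * L s)"
    unfolding assms(4) L_def H_def by (simp add: f prod.distrib mult.assoc)
  \<comment> \<open>Only p^k of the factor p^n in F is divided out; the p^(n-k) left over is the
    claimed lower bound on the order.\<close>
  have coeff: "kummer_coeff F k = padic_p ^ (n - k) * fwd_diff k L 0" if "k \<le> n" for k
    using that by (intro kummer_coeff_eqI)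
      (simp add: F fwd_diff_cmult flip: power_add mult.assoc)
  \<comment> \<open>Modulo p the unit factor \<open>H\<close> may be replaced by the constant
    \<open>c\<close>, leaving a product of linear factors whose n-th difference is known.\<close>
  have "padic_p dvd (fwd_diff n L 0 - fwd_diff n (\<lambda>s. of_nat c * (\<Prod>\<nu>=1..n. s - \<xi> \<nu>)) 0)"
    by (rule fwd_diff_cong_dvd) (simp add: L_def H_cong mult.commute flip: left_diff_distrib)
  then have top: "padic_p dvd (kummer_coeff F n - of_nat (fact n * c))"
    by (simp add: coeff fwd_diff_cmult fwd_diff_prod_linear mult.commute del: One_nat_def)
  have ord: "padic_p ^ (n - k) dvd kummer_coeff F k" if "k \<le> n" for k
    using that by (simp add: coeff)
  then have low: "kummer_coeff F k \<notin> padic_units" if "k < n" for k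
    using that by (metis padic_unit_iff dvd_power dvd_trans less_imp_le zero_less_diff)
  have "kummer_coeff F n \<in> padic_units \<longleftrightarrow> \<not> CARD('p) dvd fact n * c"
    unfolding padic_unit_iff padic_p_dvd_of_nat_iff[symmetric]
    using dvd_add_right_iff[OF top, of "of_nat (fact n * c)"] by simp
  \<comment> \<open>As p does not divide \<open>c\<close>, everything rests on n!, which p divides
    exactly when p <= n.\<close>
  also have "\<dots> \<longleftrightarrow> n < CARD('p)"
    using c p by (simp add: prime_dvd_mult_iff prime_dvd_fact_iff not_le)
  finally have unit: "kummer_coeff F n \<in> padic_units \<longleftrightarrow> n < CARD('p)" .
  have lambda: "if n < CARD('p) then kummer_lambda F = enat n else kummer_lambda F > enat n"
  proof (cases "n < CARD('p)")
    case True
    have "enat n \<le> kummer_lambda F"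
      unfolding enat_le_kummer_lambda_iff using low by blast
    moreover have "\<not> enat (Suc n) \<le> kummer_lambda F"
      unfolding enat_le_kummer_lambda_iff using unit True by blast
    ultimately show ?thesis
      using True by (simp add: Suc_ile_eq)
  next
    case False
    have "enat (Suc n) \<le> kummer_lambda F"
      unfolding enat_le_kummer_lambda_iff using low unit False by (metis less_antisym)
    then show ?thesis
      using False by (simp add: Suc_ile_eq)
  qed
  have factor: "F s = padic_p ^ n * (\<Prod>\<nu>=1..n. s - \<xi> \<nu>) * H s" for s
    unfolding F L_def by (rule mult.assoc[symmetric])
  have "\<forall>k\<in>{0..n}. padic_ord (kummer_coeff F k) \<ge> enat (n - k)"
    unfolding le_padic_ord_iff using ord by simp
  moreover have "continuous_on UNIV H \<and> (\<forall>s. H s \<in> padic_units) \<and>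
      (\<forall>s. F s = padic_p ^ n * (\<Prod>\<nu>=1..n. s - \<xi> \<nu>) * H s) \<and>
      (\<forall>s. padic_cong (H s) (of_nat c))"
    unfolding padic_cong_def using H_cont H_unit factor H_cong by blast
  ultimately show ?thesis
    using top lambda unfolding c_def padic_cong_def by blast
qed

end
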